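(* Let $g:[0,\infty)\to(0,\infty)$ be a positive, (strictly) increasing and differentiable function, let $q\in(0,1)$ and let $k\ge 1$ be real. Let $\lambda,\mu$ be positive real numbers such that $\lambda\ge\mu$. Then for all real $x,y$ with $0<x<y$, $$\frac{(1-q)^{\lambda(g(0)-g(x))}\,\Gamma_q(g(0))^\lambda}{(1-q)^{\frac{\mu}{k}(g(0)-g(x))}\,\Gamma_{(q,k)}(g(0))^\mu}\;\ge\;\frac{\Gamma_q(g(x))^\lambda}{\Gamma_{(q,k)}(g(x))^\mu}\;\ge\;\frac{(1-q)^{\lambda(g(y)-g(x))}\,\Gamma_q(g(y))^\lambda}{(1-q)^{\frac{\mu}{k}(g(y)-g(x))}\,\Gamma_{(q,k)}(g(y))^\mu}.$$
   Context: For $q\in(0,1)$ and real $t>0$, the $q$-Gamma function is $$\Gamma_q(t)=(1-q)^{1-t}\prod_{n=0}^{\infty}\frac{1-q^{n+1}}{1-q^{n+t}}.$$ For $q\in(0,1)$, $k>0$ and $t>0$, the $(q,k)$-Gamma function (Díaz–Teruel) is $$\Gamma_{(q,k)}(t)=\frac{(1-q^k)_{q,k}^{\frac{t}{k}-1}}{(1-q)^{\frac{t}{k}-1}},$$ where $(1+x)_{q,k}^{\infty}=\prod_{j=0}^{\infty}(1+q^{jk}x)$ and $(1+x)_{q,k}^{s}=\frac{(1+x)_{q,k}^{\infty}}{(1+q^{ks}x)_{q,k}^{\infty}}$ for real $s$; explicitly, $$(1-q^k)_{q,k}^{\frac{t}{k}-1}=\prod_{j=0}^{\infty}\frac{1-q^{(j+1)k}}{1-q^{t+jk}}.$$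 *)

theory Defs
  imports "HOL-Analysis.Analysis"
begin

text \<open>
  All definitions are meant for \<open>0 < q < 1\<close>, \<open>k > 0\<close> and \<open>t > 0\<close>, where the infinite
  products converge. Powers with a real exponent are written with \<^const>\<open>powr\<close>,
  which agrees with the usual power since all bases involved are positive.
\<close>

definition q_Gamma :: "real \<Rightarrow> real \<Rightarrow> real" where
  "q_Gamma q t = (1 - q) powr (1 - t) * (\<Prod>n. (1 - q ^ (n + 1)) / (1 - q powr (real n + t)))"

text \<open>\<open>qk_prod q k x\<close> is \<open>(1 + x)\<close> with lower index \<open>q,k\<close> and upper index \<open>\<infinity>\<close>;
  \<open>qk_power q k x s\<close> is the same with upper index \<open>s\<close>. The argument is \<open>x\<close>, not \<open>1 + x\<close>.\<close>

definition qk_prod :: "real \<Rightarrow> real \<Rightarrow> real \<Rightarrow> real" where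
  "qk_prod q k x = (\<Prod>j. 1 + q powr (real j * k) * x)"

definition qk_power :: "real \<Rightarrow> real \<Rightarrow> real \<Rightarrow> real \<Rightarrow> real" where
  "qk_power q k x s = qk_prod q k x / qk_prod q k (q powr (k * s) * x)"

definition qk_Gamma :: "real \<Rightarrow> real \<Rightarrow> real \<Rightarrow> real" where
  "qk_Gamma q k t = qk_power q k (- (q powr k)) (t / k - 1) / (1 - q) powr (t / k - 1)"

lemma convergent_qk_prod:
  fixes q k c :: real
  assumes "0 < q" "q < 1" "0 < k"
  shows "convergent_prod (\<lambda>j. 1 + q powr (real j * k) * c)"
proof -
  have "\<bar>q powr k\<bar> < 1"
    using assms by (simp add: powr01_less_one)
  then have "summable (\<lambda>j. (q powr k) ^ j * \<bar>c\<bar>)"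
    by (intro summable_mult2 summable_geometric) simp
  moreover have "(\<lambda>j. norm (q powr (real j * k) * c)) = (\<lambda>j. (q powr k) ^ j * \<bar>c\<bar>)"
    using assms by (auto simp: abs_mult powr_powr powr_realpow[symmetric] mult.commute)
  ultimately show ?thesis
    by (intro abs_convergent_prod_imp_convergent_prod summable_imp_abs_convergent_prod) simp
qed

lemma qk_Gamma_explicit:
  fixes q k t :: real
  assumes "0 < q" "q < 1" "0 < k" "0 < t"
  shows "qk_Gamma q k t =
    (\<Prod>j. (1 - q powr (real (j + 1) * k)) / (1 - q powr (t + real j * k))) / (1 - q) powr (t / k - 1)"
proof -
  have e1: "1 + q powr (real j * k) * - (q powr k) = 1 - q powr (real (j + 1) * k)" for j
    by (simp add: powr_add[symmetric] algebra_simps)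
  have e2: "1 + q powr (real j * k) * (q powr (k * (t / k - 1)) * - (q powr k))
      = 1 - q powr (t + real j * k)" for j
    using assms by (simp add: powr_add[symmetric] algebra_simps)
  have "0 < t + real j * k" for j
    using assms by (simp add: add_pos_nonneg)
  then have nz: "1 - q powr (t + real j * k) \<noteq> 0" for j
    using assms powr01_less_one[of q "t + real j * k"] by fastforce
  have c1: "convergent_prod (\<lambda>j. 1 - q powr (real (j + 1) * k))"
    using convergent_qk_prod[OF assms(1-3), of "- (q powr k)"] by (simp only: e1)
  have c2: "convergent_prod (\<lambda>j. 1 - q powr (t + real j * k))"
    using convergent_qk_prod[OF assms(1-3), of "q powr (k * (t / k - 1)) * - (q powr k)"]
    by (simp only: e2)
  show ?thesis
    unfolding qk_Gamma_def qk_power_def qk_prod_def e1 e2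
    by (subst prodinf_divide[OF c1 c2]) (use nz in auto)
qed

end

theory Submission
  imports Defs
begin

text \<open>
  Write \<open>E\<^sub>k(t) = (1 - q)\<^bsup>t/k\<^esup> \<Gamma>\<^bsub>(q,k)\<^esub>(t)\<close>. The power of \<open>1 - q\<close> cancels the one hidden in the
  \<open>(q,k)\<close>-Gamma function, so that \<open>E\<^sub>k(t)\<close> is a constant in \<open>t\<close> divided by
  \<open>\<Prod>j. 1 - q\<^bsup>t + jk\<^esup>\<close>. Since \<open>\<Gamma>\<^sub>q\<close> is the case \<open>k = 1\<close> (lemma \<open>q_Gamma_eq_qk_Gamma_1\<close>), each of
  the three expressions to be compared is the value of \<open>F = E\<^sub>1\<^bsup>\<lambda>\<^esup> / E\<^sub>k\<^bsup>\<mu>\<^esup>\<close> at \<open>g(0)\<close>, \<open>g(x)\<close> or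
  \<open>g(y)\<close>, divided by one common positive factor, the power of \<open>1 - q\<close> with exponent
  \<open>(\<lambda> - \<mu>/k) g(x)\<close> (lemma \<open>weighted_Gamma_quotient\<close>). As \<open>g\<close> increases, it is enough that \<open>F\<close> is
  nonincreasing on the positive half-line (lemma \<open>Gamma_quotient_antimono\<close>).

  For \<open>0 < a \<le> b\<close> the ratio \<open>E\<^sub>k(a) / E\<^sub>k(b)\<close> is the product over \<open>j\<close> of
  \<open>(1 - q\<^bsup>b + jk\<^esup>) / (1 - q\<^bsup>a + jk\<^esup>)\<close>. Every factor is at least 1, and it is nondecreasing in \<open>q\<^bsup>jk\<^esup>\<close>,
  hence nonincreasing in \<open>k\<close>. So \<open>1 \<le> E\<^sub>k(a) / E\<^sub>k(b) \<le> E\<^sub>1(a) / E\<^sub>1(b)\<close> for \<open>k \<ge> 1\<close>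
  (lemma \<open>qk_prod_ratio_bounds\<close>), and raising the left ratio to the power \<open>\<mu>\<close> and the
  right one to the larger power \<open>\<lambda>\<close> preserves the inequality, because both are at
  least 1.
\<close>

lemma qk_prod_factor_pos:
  fixes q k t :: real
  assumes "0 < q" "q < 1" "0 < k" "0 < t"
  shows "0 < 1 + q powr (real j * k) * - (q powr t)"
proof -
  have "q powr (real j * k + t) < 1"
    using assms powr01_less_one[of q "real j * k + t"] by (simp add: add_nonneg_pos)
  then show ?thesis by (simp add: powr_add)
qed

lemma qk_prod_pos:
  fixes q k t :: real
  assumes "0 < q" "q < 1" "0 < k" "0 < t"
  shows "0 < qk_prod q k (- (q powr t))"
proof -
  have "convergent_prod (\<lambda>j. 1 + q powr (real j * k) * - (q powr t))"
    using assms by (intro convergent_qk_prod)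
  then show ?thesis
    unfolding qk_prod_def
    using qk_prod_factor_pos[OF assms] by (intro less_0_prodinf) (auto simp: less_imp_le)
qed

text \<open>
  This normalization leaves \<open>t\<close> only in the infinite product in the denominator, so
  ratios at two arguments become ratios of such products.
\<close>

lemma powr_times_qk_Gamma:
  fixes q k t :: real
  assumes "0 < q" "q < 1" "0 < k"
  shows "(1 - q) powr (t / k) * qk_Gamma q k t
    = (1 - q) * qk_prod q k (- (q powr k)) / qk_prod q k (- (q powr t))"
proof -
  have "q powr (k * (t / k - 1)) * - (q powr k) = - (q powr t)"
    using assms by (simp add: powr_add[symmetric] algebra_simps)
  then show ?thesis
    using assms by (simp add: qk_Gamma_def qk_power_def powr_diff)
qed

lemma qk_Gamma_pos:
  fixes q k t :: real
  assumes "0 < q" "q < 1" "0 < k" "0 < t"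
  shows "0 < qk_Gamma q k t"
proof -
  have "0 < (1 - q) powr (t / k) * qk_Gamma q k t"
    unfolding powr_times_qk_Gamma[OF assms(1-3)]
    using assms by (simp add: qk_prod_pos)
  then show ?thesis using assms by (simp add: zero_less_mult_iff)
qed

text \<open>
  This makes the quotients below compare one family at the steps 1 and \<open>k\<close>, instead of
  two different functions.
\<close>

lemma q_Gamma_eq_qk_Gamma_1:
  fixes q t :: real
  assumes "0 < q" "q < 1" "0 < t"
  shows "q_Gamma q t = qk_Gamma q 1 t"
proof -
  have "q powr real (j + 1) = q ^ (j + 1)" for j
    using assms powr_realpow[of q "j + 1"] by blast
  moreover have "(1 - q) powr (1 - t) = 1 / (1 - q) powr (t - 1)"
    by (metis minus_diff_eq powr_minus_divide)
  ultimately show ?thesis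
    using assms by (simp add: q_Gamma_def qk_Gamma_explicit add.commute)
qed

text \<open>
  With \<open>u = q\<^bsup>jk\<^esup>\<close>, the ratio of corresponding factors is \<open>(1 - u q\<^bsup>b\<^esup>) / (1 - u q\<^bsup>a\<^esup>)\<close>. It is nondecreasing
  in \<open>u\<close> because \<open>q\<^bsup>b\<^esup> \<le> q\<^bsup>a\<^esup>\<close>, and it is 1 at \<open>u = 0\<close>. A larger step \<open>k\<close> never gives
  a larger \<open>u\<close>, for any \<open>j\<close>, so the bounds hold factor by factor and pass to the
  infinite products.
\<close>

lemma qk_prod_ratio_bounds:
  fixes q k l a b :: real
  assumes q: "0 < q" "q < 1" and kl: "0 < l" "l \<le> k" and ab: "0 < a" "a \<le> b"
  defines "R \<equiv> \<lambda>k. qk_prod q k (- (q powr b)) / qk_prod q k (- (q powr a))"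
  shows "1 \<le> R k" "R k \<le> R l"
proof -
  have k0: "0 < k" and b0: "0 < b" using kl ab by auto
  define f where "f \<equiv> \<lambda>k t j. 1 + q powr (real j * k) * - (q powr t)"
  have f_pos: "0 < f m t j" if "0 < m" "0 < t" for m t j
    unfolding f_def using qk_prod_factor_pos[OF q that] .
  have conv: "convergent_prod (f m t)" if "0 < m" for m t
    unfolding f_def using convergent_qk_prod[OF q that] .
  have R: "(\<lambda>j. f m b j / f m a j) has_prod R m" if m: "0 < m" for m
  proof -
    have "(\<lambda>j. f m t j) has_prod qk_prod q m (- (q powr t))" for t
      using convergent_prod_has_prod[OF conv[OF m, of t]] by (simp add: f_def qk_prod_def)
    then show ?thesis
      unfolding R_def using f_pos[OF m ab(1)] by (intro has_prod_divide) (metis less_irrefl)+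
  qed
  have qab: "q powr b \<le> q powr a"
    using q ab by (simp add: powr_mono')
  have ge1: "1 \<le> f m b j / f m a j" if m: "0 < m" for m j
    using f_pos[OF m ab(1), of j] mult_left_mono[OF qab, of "q powr (real j * m)"]
    by (simp add: f_def)
  have le: "f k b j / f k a j \<le> f l b j / f l a j" for j
  proof -
    have u: "q powr (real j * k) \<le> q powr (real j * l)"
      using q kl by (intro powr_mono') (auto simp: mult_left_mono)
    \<comment> \<open>This product is the difference of the two sides of the cross-multiplied inequality.\<close>
    have "0 \<le> (q powr (real j * l) - q powr (real j * k)) * (q powr a - q powr b)"
      using u qab by simp
    then have "f k b j * f l a j \<le> f l b j * f k a j"
      by (simp add: f_def algebra_simps)
    then show ?thesis
      using f_pos[OF k0 ab(1), of j] f_pos[OF kl(1) ab(1), of j] by (simp add: divide_simps)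
  qed
  show "1 \<le> R k"
    using has_prod_le[OF has_prod_single[of 0 "\<lambda>_. 1"] R[OF k0]] ge1[OF k0] by auto
  show "R k \<le> R l"
    using le ge1[OF k0] by (intro has_prod_le[OF R[OF k0] R[OF kl(1)]]) (meson order_trans zero_le_one)
qed

text \<open>
  Splitting the exponents \<open>s - c\<close> separates the variable point \<open>s\<close> from the reference
  point \<open>c\<close>, whose contribution is the same for all \<open>s\<close> and so is irrelevant for
  monotonicity in \<open>s\<close>.
\<close>

lemma weighted_Gamma_quotient:
  fixes q k lam mu s c :: real
  assumes "0 < q" "q < 1" "0 < k" "0 < s"
  shows "((1 - q) powr (lam * (s - c)) * qk_Gamma q 1 s powr lam)
        / ((1 - q) powr (mu / k * (s - c)) * qk_Gamma q k s powr mu)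
    = ((1 - q) powr s * qk_Gamma q 1 s) powr lam / ((1 - q) powr (s / k) * qk_Gamma q k s) powr mu
        / (1 - q) powr (lam * c - mu / k * c)"
proof -
  have *: "0 < qk_Gamma q 1 s" "0 < qk_Gamma q k s" "0 < 1 - q"
    using assms qk_Gamma_pos by auto
  then show ?thesis
    by (simp add: powr_mult powr_powr right_diff_distrib diff_divide_distrib powr_diff mult.commute)
qed

text \<open>
  After rearranging, the claim is \<open>r\<^sub>k\<^bsup>\<mu>\<^esup> \<le> r\<^sub>1\<^bsup>\<lambda>\<^esup>\<close> for the ratios \<open>r\<^sub>m = E\<^sub>m(a) / E\<^sub>m(b)\<close>. It goes
  through \<open>r\<^sub>1\<^bsup>\<mu>\<^esup>\<close>: first the base grows from \<open>r\<^sub>k\<close> to \<open>r\<^sub>1\<close>, then the exponent grows from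
  \<open>\<mu>\<close> to \<open>\<lambda>\<close>, which needs \<open>1 \<le> r\<^sub>1\<close>.
\<close>

lemma Gamma_quotient_antimono:
  fixes q k lam mu a b :: real
  assumes q: "0 < q" "q < 1" and k: "1 \<le> k" and lm: "0 < mu" "mu \<le> lam"
    and ab: "0 < a" "a \<le> b"
  defines "E \<equiv> \<lambda>k t. (1 - q) powr (t / k) * qk_Gamma q k t"
  shows "E 1 b powr lam / E k b powr mu \<le> E 1 a powr lam / E k a powr mu"
proof -
  have k0: "0 < k" and b0: "0 < b" using k ab by auto
  have pos: "0 < E m t" if "0 < m" "0 < t" for m t
    using q qk_Gamma_pos[OF q that] by (simp add: E_def)
  have ratio: "E m a / E m b = qk_prod q m (- (q powr b)) / qk_prod q m (- (q powr a))"
    if m: "0 < m" for m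
    unfolding E_def powr_times_qk_Gamma[OF q m] using q qk_prod_pos[OF q m m] by simp
  have ge1: "1 \<le> E k a / E k b" and le: "E k a / E k b \<le> E 1 a / E 1 b"
    unfolding ratio[OF k0] ratio[OF zero_less_one]
    using qk_prod_ratio_bounds[OF q zero_less_one k ab] by auto
  have "(E k a / E k b) powr mu \<le> (E 1 a / E 1 b) powr mu"
    using ge1 le lm by (intro powr_mono2) auto
  also have "\<dots> \<le> (E 1 a / E 1 b) powr lam"
    using ge1 le lm by (intro powr_mono) auto
  finally have "E k a powr mu / E k b powr mu \<le> E 1 a powr lam / E 1 b powr lam"
    using pos[OF k0] pos[of 1] ab b0 by (simp add: powr_divide less_imp_le)
  then show ?thesis
    using pos[OF k0 ab(1)] pos[OF k0 b0] pos[OF zero_less_one ab(1)] pos[OF zero_less_one b0]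
    by (simp add: field_simps)
qed

theorem theorem2p6:
  fixes g :: "real \<Rightarrow> real" and q k lam mu x y :: real
  assumes g_pos: "\<And>u. 0 \<le> u \<Longrightarrow> 0 < g u"
    and g_incr: "strict_mono_on {0..} g"
    and g_diff: "g differentiable_on {0..}"
    and q: "0 < q" "q < 1"
    and k: "1 \<le> k"
    and lam_mu: "0 < lam" "0 < mu" "mu \<le> lam"
    and xy: "0 < x" "x < y"
  shows "((1 - q) powr (lam * (g 0 - g x)) * q_Gamma q (g 0) powr lam)
           / ((1 - q) powr (mu / k * (g 0 - g x)) * qk_Gamma q k (g 0) powr mu)
         \<ge> q_Gamma q (g x) powr lam / qk_Gamma q k (g x) powr mu
       \<and> q_Gamma q (g x) powr lam / qk_Gamma q k (g x) powr mu
         \<ge> ((1 - q) powr (lam * (g y - g x)) * q_Gamma q (g y) powr lam)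
           / ((1 - q) powr (mu / k * (g y - g x)) * qk_Gamma q k (g y) powr mu)"
proof -
  \<comment> \<open>The outer expressions are the values at \<open>g 0\<close> and \<open>g y\<close>. At \<open>g x\<close> both powers of
    \<open>1 - q\<close> have exponent 0, which gives the middle one.\<close>
  define V where "V \<equiv> \<lambda>s. ((1 - q) powr (lam * (s - g x)) * q_Gamma q s powr lam)
           / ((1 - q) powr (mu / k * (s - g x)) * qk_Gamma q k s powr mu)"
  have V_antimono: "V b \<le> V a" if ab: "0 < a" "a \<le> b" for a b
  proof -
    have b0: "0 < b" using ab by simp
    have k0: "0 < k" using k by simp
    show ?thesis
      unfolding V_def q_Gamma_eq_qk_Gamma_1[OF q ab(1)] q_Gamma_eq_qk_Gamma_1[OF q b0]
        weighted_Gamma_quotient[OF q k0 ab(1)] weighted_Gamma_quotient[OF q k0 b0]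
      using Gamma_quotient_antimono[OF q k lam_mu(2,3) ab] by (intro divide_right_mono) simp_all
  qed
  have "g 0 < g x" "g x < g y"
    using xy strict_mono_onD[OF g_incr] by auto
  then have "V (g x) \<le> V (g 0)" "V (g y) \<le> V (g x)"
    using g_pos xy by (auto intro!: V_antimono)
  moreover have "V (g x) = q_Gamma q (g x) powr lam / qk_Gamma q k (g x) powr mu"
    using q by (simp add: V_def)
  ultimately show ?thesis by (simp add: V_def)
qed

end
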